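(* Let $A\in(1,2]$. The equation $$\Phi_1(r):=\frac{A+1}{2}\left(\frac{1-r}{1+r}\right)-e^r-r=0$$ has a unique root $R=R_{\mathcal{S}_e^*,\mathcal{C}_c(A)}$ in $(0,1)$, and for every $f\in\mathcal{S}_e^*$ one has $$\operatorname{Re}\{T_f(z)\}>0\qquad\text{for all } z \text{ with } |z|<R.$$ Moreover, this radius is sharp: $R$ is the largest number in $(0,1]$ such that $\operatorname{Re}\{T_f(z)\}>0$ for all $|z|<R$ and every $f\in\mathcal{S}_e^*$.
   Context: Let $\mathbb{D}=\{z\in\mathbb{C}:|z|<1\}$. Let $\mathcal{A}$ be the class of analytic functions $f$ on $\mathbb{D}$ with $f(0)=0$ and $f'(0)=1$, and let $\mathcal{S}\subset\mathcal{A}$ be the subclass of functions that are univalent (injective) in $\mathbb{D}$. For analytic functions $f,g$ on $\mathbb{D}$, $f$ is subordinate to $g$, written $f\prec g$, if there is an analytic function $\omega$ on $\mathbb{D}$ with $\omega(0)=0$ and $|\omega(z)|<1$ for all $z\in\mathbb{D}$ (a Schwarz function) such that $f(z)=g(\omega(z))$ for all $z\in\mathbb{D}$. The class $\mathcal{S}_e^*$ is $$\mathcal{S}_e^*:=\left\{f\in\mathcal{S}:\frac{zf'(z)}{f(z)}\prec e^z\right\},$$ where $zf'(z)/f(z)$ is understood to take the value $1$ at $z=0$. For $A\in(1,2]$ and $f\in\mathcal{S}$, the Avkhadiev--Wirths operator is $$T_f(z)=\frac{2}{A-1}\left[\frac{A+1}{2}\left(\frac{1+z}{1-z}\right)-1-\frac{zf''(z)}{f'(z)}\right],\qquad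 z\in\mathbb{D}.$$ For a family $\mathcal{F}\subset\mathcal{A}$, the radius of concavity $R_{\mathcal{F},\mathcal{C}_c(A)}$ of $\mathcal{F}$ is the largest number in $(0,1]$ such that $\operatorname{Re}\{T_f(z)\}>0$ for all $|z|<R_{\mathcal{F},\mathcal{C}_c(A)}$ and every $f\in\mathcal{F}$. *)

theory Defs
  imports "HOL-Complex_Analysis.Complex_Analysis"
begin

abbreviation unit_disc :: "complex set" ("\<D>") where
  "\<D> \<equiv> ball 0 1"

text \<open>Functions on the disc are total functions on the complex plane. Their values outside the disc
  are irrelevant: \<^term>\<open>deriv f z\<close> at a point of the open disc depends only on the values of
  \<^term>\<open>f\<close> near that point.\<close>

definition class_A :: "(complex \<Rightarrow> complex) set" where
  "class_A = {f. f holomorphic_on \<D> \<and> f 0 = 0 \<and> deriv f 0 = 1}"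

definition class_S :: "(complex \<Rightarrow> complex) set" where
  "class_S = {f \<in> class_A. inj_on f \<D>}"

definition schwarz_function :: "(complex \<Rightarrow> complex) \<Rightarrow> bool" where
  "schwarz_function \<omega> \<longleftrightarrow> \<omega> holomorphic_on \<D> \<and> \<omega> 0 = 0 \<and> (\<forall>z\<in>\<D>. norm (\<omega> z) < 1)"

definition subordinate :: "(complex \<Rightarrow> complex) \<Rightarrow> (complex \<Rightarrow> complex) \<Rightarrow> bool"  (infix "\<prec>\<^sub>s" 50) where
  "f \<prec>\<^sub>s g \<longleftrightarrow> (\<exists>\<omega>. schwarz_function \<omega> \<and> (\<forall>z\<in>\<D>. f z = g (\<omega> z)))"

text \<open>The quotient \<open>z f'(z) / f(z)\<close>, with its removable singularity at the origin filled in.\<close>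

definition starlike_quotient :: "(complex \<Rightarrow> complex) \<Rightarrow> complex \<Rightarrow> complex" where
  "starlike_quotient f z = (if z = 0 then 1 else z * deriv f z / f z)"

definition class_S_e :: "(complex \<Rightarrow> complex) set" where
  "class_S_e = {f \<in> class_S. starlike_quotient f \<prec>\<^sub>s exp}"

definition T_op :: "real \<Rightarrow> (complex \<Rightarrow> complex) \<Rightarrow> complex \<Rightarrow> complex" where
  "T_op A f z = 2 / (of_real A - 1) *
     ((of_real A + 1) / 2 * ((1 + z) / (1 - z)) - 1 - z * deriv (deriv f) z / deriv f z)"

definition concave_up_to :: "real \<Rightarrow> (complex \<Rightarrow> complex) set \<Rightarrow> real \<Rightarrow> bool" where
  "concave_up_to A F \<rho> \<longleftrightarrow> (\<forall>f\<in>F. \<forall>z. norm z < \<rho> \<longrightarrow> Re (T_op A f z) > 0)"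

text \<open>A relation rather than a function, so that the existence of a largest number is part of
  what it asserts.\<close>

definition is_radius_of_concavity :: "real \<Rightarrow> (complex \<Rightarrow> complex) set \<Rightarrow> real \<Rightarrow> bool" where
  "is_radius_of_concavity A F R \<longleftrightarrow>
     R \<in> {0<..1} \<and> concave_up_to A F R \<and> (\<forall>\<rho>\<in>{0<..1}. concave_up_to A F \<rho> \<longrightarrow> \<rho> \<le> R)"

definition Phi1 :: "real \<Rightarrow> real \<Rightarrow> real" where
  "Phi1 A r = (A + 1) / 2 * ((1 - r) / (1 + r)) - exp r - r"

end

theory Submission
  imports Defs
begin

text \<open>For \<open>f\<close> in the class there is a Schwarz function \<open>\<omega>\<close> with \<open>z f'(z) = f(z) e\<^bsup>\<omega>(z)\<^esup>\<close>, and
  differentiating this equation gives \<open>1 + z f''(z) / f'(z) = e\<^bsup>\<omega>(z)\<^esup> + z \<omega>'(z)\<close>. Put \<open>r = |z|\<close> and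
  \<open>t = |\<omega>(z)| \<le> r\<close>. The Schwarz--Pick inequality bounds the right-hand side by
  \<open>e\<^bsup>t\<^esup> + r (1 - t\<^sup>2) / (1 - r\<^sup>2)\<close>, and for \<open>r \<le> 1/2\<close> this is largest at \<open>t = r\<close>, where it equals
  \<open>e\<^bsup>r\<^esup> + r\<close>. On the other hand the real part of \<open>(1 + z) / (1 - z)\<close> is at least
  \<open>(1 - r) / (1 + r)\<close>. Hence \<open>Re T\<^sub>f(z)\<close> is at least \<open>2 / (A - 1)\<close> times \<open>\<Phi>\<^sub>1(r)\<close>. Since \<open>\<Phi>\<^sub>1\<close> is strictly
  decreasing from a positive to a negative value, and is negative from \<open>1/2\<close> on because \<open>A \<le> 2\<close>, its
  root is unique, lies below \<open>1/2\<close>, and \<open>\<Phi>\<^sub>1\<close> is positive before it.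

  All the estimates are attained simultaneously for \<open>\<omega>(z) = -z\<close> at \<open>z = -r\<close>. The corresponding
  function is \<open>f(z) = z e\<^bsup>h(z)\<^esup>\<close> with \<open>h'(z) = (e\<^bsup>-z\<^esup> - 1) / z\<close> and \<open>h(0) = 0\<close>, for which
  \<open>Re T\<^sub>f(-R) = 0\<close> at the root \<open>R\<close>. The point that needs an argument is that this \<open>f\<close> is univalent:
  its logarithm in the variable \<open>s = log z\<close> is \<open>s + h(e\<^bsup>s\<^esup>)\<close>, which is injective on the left half-plane
  because its derivative \<open>e\<^bsup>-z\<^esup>\<close> has positive real part.\<close>

section \<open>The Schwarz--Pick inequality for the derivative\<close>

lemma Moebius_function_has_field_derivative:
  assumes "norm w < 1" "norm z < 1"
  shows "(Moebius_function 0 w has_field_derivative (1 - of_real ((norm w)\<^sup>2)) / (1 - cnj w * z)\<^sup>2) (at z)"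
proof -
  have "norm (cnj w * z) < 1"
    using assms norm_mult_less[of "cnj w" 1 z 1] by simp
  hence nz: "1 - cnj w * z \<noteq> 0" by auto
  have "((\<lambda>z. (z - w) / (1 - cnj w * z)) has_field_derivative
      (1 * (1 - cnj w * z) - (z - w) * (- cnj w)) / ((1 - cnj w * z) * (1 - cnj w * z))) (at z)"
    by (rule DERIV_divide) (use nz in \<open>auto intro!: derivative_eq_intros\<close>)
  moreover have "1 * (1 - cnj w * z) - (z - w) * (- cnj w) = 1 - of_real ((norm w)\<^sup>2)"
    unfolding complex_norm_square by (simp add: algebra_simps)
  moreover have "Moebius_function 0 w = (\<lambda>z. (z - w) / (1 - cnj w * z))"
    by (rule ext) (rule Moebius_function_simple)
  ultimately show ?thesis by (simp only: power2_eq_square)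
qed

text \<open>Moving \<open>a\<close> and \<open>f(a)\<close> to the origin by disc automorphisms reduces this to the bound
  \<open>|g'(0)| \<le> 1\<close> of the Schwarz lemma.\<close>

lemma Schwarz_Pick_deriv:
  assumes holf: "f holomorphic_on \<D>" and bdd: "\<And>z. norm z < 1 \<Longrightarrow> norm (f z) < 1" and a: "norm a < 1"
  shows "norm (deriv f a) * (1 - (norm a)\<^sup>2) \<le> 1 - (norm (f a))\<^sup>2"
proof -
  define M where "M = Moebius_function 0 (f a)"
  define N where "N = Moebius_function 0 (- a)"
  define g where "g = (\<lambda>z. M (f (N z)))"
  have b: "norm (f a) < 1" by (rule bdd[OF a])
  have N0: "N 0 = a" by (simp add: N_def Moebius_function_simple)
  have N1: "norm (N z) < 1" if "norm z < 1" for z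
    unfolding N_def by (rule Moebius_function_norm_lt_1) (use a that in auto)
  have holg: "g holomorphic_on \<D>"
  proof -
    have "N holomorphic_on \<D>" unfolding N_def by (rule Moebius_function_holomorphic) (use a in auto)
    moreover have "M holomorphic_on \<D>" unfolding M_def by (rule Moebius_function_holomorphic) (rule b)
    ultimately have "(M \<circ> (f \<circ> N)) holomorphic_on \<D>"
      by (intro holomorphic_on_compose_gen[of _ _ _ \<D>] holf) (use N1 bdd in auto)
    thus ?thesis by (simp add: g_def o_def)
  qed
  have g0: "g 0 = 0" by (simp add: g_def N0 M_def Moebius_function_eq_zero)
  have g1: "norm (g z) < 1" if "norm z < 1" for z
    unfolding g_def M_def by (rule Moebius_function_norm_lt_1) (use b that N1 bdd in auto)
  have dg: "norm (deriv g 0) \<le> 1"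
    by (rule Schwarz_Lemma(2)[OF holg g0 g1, of 0]) auto
  have pos: "0 < 1 - (norm (f a))\<^sup>2" "0 < 1 - (norm a)\<^sup>2"
    using a b by (simp_all add: power_less_one_iff)
  have dN: "(N has_field_derivative of_real (1 - (norm a)\<^sup>2)) (at 0)"
    using Moebius_function_has_field_derivative[of "- a" 0] a by (simp add: N_def)
  have "(M has_field_derivative (1 - of_real ((norm (f a))\<^sup>2)) / (1 - cnj (f a) * f a)\<^sup>2) (at (f a))"
    unfolding M_def by (rule Moebius_function_has_field_derivative[OF b b])
  moreover have "(1 - of_real ((norm (f a))\<^sup>2)) / (1 - cnj (f a) * f a)\<^sup>2
      = (of_real (inverse (1 - (norm (f a))\<^sup>2)) :: complex)"
  proof -
    have eq: "1 - cnj (f a) * f a = (of_real (1 - (norm (f a))\<^sup>2) :: complex)"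
      using complex_norm_square[of "f a"] by (simp add: mult.commute)
    show ?thesis unfolding eq using pos(1)
      by (simp add: power2_eq_square inverse_eq_divide del: of_real_mult)
  qed
  ultimately have dM: "(M has_field_derivative of_real (inverse (1 - (norm (f a))\<^sup>2))) (at (f (N 0)))"
    by (simp add: N0)
  have "(f has_field_derivative deriv f a) (at a)"
    by (rule holomorphic_derivI[OF holf]) (use a in auto)
  hence df: "(f has_field_derivative deriv f a) (at (N 0))"
    by (simp add: N0)
  have "(g has_field_derivative
      of_real (inverse (1 - (norm (f a))\<^sup>2)) * (deriv f a * of_real (1 - (norm a)\<^sup>2))) (at 0)"
    unfolding g_def
    by (rule DERIV_chain2[of M _ "\<lambda>z. f (N z)", OF dM DERIV_chain2[of f _ N, OF df dN]])
  hence "deriv g 0 = of_real (inverse (1 - (norm (f a))\<^sup>2)) * (deriv f a * of_real (1 - (norm a)\<^sup>2))"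
    by (rule DERIV_imp_deriv)
  hence "norm (deriv g 0) = inverse (1 - (norm (f a))\<^sup>2) * (norm (deriv f a) * (1 - (norm a)\<^sup>2))"
    using pos by (simp only: norm_mult norm_of_real abs_inverse abs_of_pos)
  with dg have "norm (deriv f a) * (1 - (norm a)\<^sup>2) / (1 - (norm (f a))\<^sup>2) \<le> 1"
    by (simp add: divide_inverse mult.commute)
  thus ?thesis using pos by (simp add: divide_le_eq)
qed

section \<open>The second logarithmic derivative\<close>

lemma second_logarithmic_derivative:
  assumes holf: "f holomorphic_on \<D>" and hol\<omega>: "\<omega> holomorphic_on \<D>"
    and eq: "\<And>z. z \<in> \<D> \<Longrightarrow> z * deriv f z = f z * exp (\<omega> z)"
    and z: "z \<in> \<D>" and nz: "deriv f z \<noteq> 0"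
  shows "z * deriv (deriv f) z / deriv f z = exp (\<omega> z) + z * deriv \<omega> z - 1"
proof -
  have d: "(f has_field_derivative deriv f z) (at z)"
    "(deriv f has_field_derivative deriv (deriv f) z) (at z)"
    "(\<omega> has_field_derivative deriv \<omega> z) (at z)"
    by (auto intro!: holomorphic_derivI[OF _ _ z] holomorphic_deriv holf hol\<omega>)
  have "((\<lambda>z. z * deriv f z) has_field_derivative deriv f z + z * deriv (deriv f) z) (at z)"
    using d by (auto intro!: derivative_eq_intros)
  hence "((\<lambda>z. f z * exp (\<omega> z)) has_field_derivative deriv f z + z * deriv (deriv f) z) (at z)"
    by (rule has_field_derivative_transform_within_open[OF _ open_ball z]) (rule eq)
  moreover have "((\<lambda>z. f z * exp (\<omega> z)) has_field_derivative
      deriv f z * exp (\<omega> z) + f z * exp (\<omega> z) * deriv \<omega> z) (at z)"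
    using d by (auto intro!: derivative_eq_intros)
  ultimately have "deriv f z + z * deriv (deriv f) z
      = deriv f z * exp (\<omega> z) + f z * exp (\<omega> z) * deriv \<omega> z"
    by (rule DERIV_unique)
  hence "z * deriv (deriv f) z = deriv f z * (exp (\<omega> z) + z * deriv \<omega> z - 1)"
    using eq[OF z] by (simp add: algebra_simps)
  thus ?thesis using nz by simp
qed

text \<open>Univalence keeps \<open>f\<close> from vanishing outside the origin, so the quotient in the definition of the
  class is a genuine one. The multiplied-out equation then holds at the origin too, and can be
  differentiated there without treating a removable singularity.\<close>

lemma class_S_e_schwarzE:
  assumes "f \<in> class_S_e"
  obtains \<omega> where "schwarz_function \<omega>"
    "\<And>z. z \<in> \<D> \<Longrightarrow> z * deriv f z = f z * exp (\<omega> z)" "\<And>z. z \<in> \<D> \<Longrightarrow> deriv f z \<noteq> 0"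
proof -
  obtain \<omega> where \<omega>: "schwarz_function \<omega>" "\<And>z. z \<in> \<D> \<Longrightarrow> starlike_quotient f z = exp (\<omega> z)"
    using assms by (auto simp: class_S_e_def subordinate_def)
  have f: "f 0 = 0" "deriv f 0 = 1" "inj_on f \<D>"
    using assms by (auto simp: class_S_e_def class_S_def class_A_def)
  have f_nz: "f z \<noteq> 0" if "z \<in> \<D>" "z \<noteq> 0" for z
    using inj_onD[OF f(3), of z 0] f(1) that by auto
  have eq: "z * deriv f z = f z * exp (\<omega> z)" if "z \<in> \<D>" for z
  proof (cases "z = 0")
    case False
    thus ?thesis using \<omega>(2)[OF that] f_nz[OF that False]
      by (simp add: starlike_quotient_def field_simps)
  qed (simp add: f)
  have "deriv f z \<noteq> 0" if "z \<in> \<D>" for z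
    using eq[OF that] f_nz[OF that] f(2) by (cases "z = 0") auto
  with \<omega>(1) eq show ?thesis by (rule that)
qed

lemma Re_T_op_schwarz:
  assumes "f \<in> class_S_e" "schwarz_function \<omega>"
    "\<And>z. z \<in> \<D> \<Longrightarrow> z * deriv f z = f z * exp (\<omega> z)" "z \<in> \<D>" "deriv f z \<noteq> 0"
  shows "Re (T_op A f z) =
    2 / (A - 1) * ((A + 1) / 2 * Re ((1 + z) / (1 - z)) - Re (exp (\<omega> z) + z * deriv \<omega> z))"
proof -
  have "f holomorphic_on \<D>" "\<omega> holomorphic_on \<D>"
    using assms by (auto simp: class_S_e_def class_S_def class_A_def schwarz_function_def)
  hence L: "z * deriv (deriv f) z / deriv f z = exp (\<omega> z) + z * deriv \<omega> z - 1"
    by (rule second_logarithmic_derivative) (use assms in auto)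
  have "T_op A f z = of_real (2 / (A - 1)) *
      (of_real ((A + 1) / 2) * ((1 + z) / (1 - z)) - (exp (\<omega> z) + z * deriv \<omega> z))"
    unfolding T_op_def L by simp
  thus ?thesis by (simp only: Re_complex_of_real times_complex.sel Im_complex_of_real mult_zero_left diff_0_right minus_complex.sel)
qed

section \<open>The lower bound inside the radius\<close>

lemma Re_Cayley_ge:
  assumes "norm z < 1"
  shows "(1 - norm z) / (1 + norm z) \<le> Re ((1 + z) / (1 - z))"
proof -
  define r where "r = norm z"
  have r: "0 \<le> r" "r < 1" using assms by (auto simp: r_def)
  have nz: "0 < norm (1 - z)" using assms by auto
  have "Re ((1 + z) / (1 - z)) = (1 - r\<^sup>2) / (norm (1 - z))\<^sup>2"
    by (simp add: Re_divide' r_def cmod_power2) (simp add: power2_eq_square algebra_simps)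
  moreover have "(1 - r\<^sup>2) / (1 + r)\<^sup>2 \<le> (1 - r\<^sup>2) / (norm (1 - z))\<^sup>2"
  proof (rule divide_left_mono)
    show "(norm (1 - z))\<^sup>2 \<le> (1 + r)\<^sup>2"
      using norm_triangle_ineq4[of 1 z] by (intro power_mono) (auto simp: r_def)
    show "0 \<le> 1 - r\<^sup>2" using r by (simp add: power_le_one)
    show "0 < (1 + r)\<^sup>2 * (norm (1 - z))\<^sup>2" using r nz by auto
  qed
  moreover have "(1 - r\<^sup>2) / (1 + r)\<^sup>2 = (1 - r) / (1 + r)"
    using r by (simp add: divide_simps) (simp add: power2_eq_square algebra_simps)
  ultimately show ?thesis by (simp add: r_def)
qed

text \<open>Passing from \<open>t\<close> to \<open>r\<close> increases the exponential by at least \<open>r - t\<close>, and decreases the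
  second term by \<open>(r - t) r (r + t) / (1 - r\<^sup>2)\<close>, which is at most \<open>r - t\<close> as long as \<open>3 r\<^sup>2 \<le> 1\<close>.\<close>

lemma exp_add_Schwarz_Pick_bound_le:
  fixes r t :: real
  assumes "0 \<le> t" "t \<le> r" "r \<le> 1 / 2"
  shows "exp t + r * ((1 - t\<^sup>2) / (1 - r\<^sup>2)) \<le> exp r + r"
proof -
  have r2: "r\<^sup>2 \<le> 1 / 4"
    using power_mono[of r "1/2" 2] assms by (simp add: power2_eq_square)
  have "exp t * (1 + (r - t)) \<le> exp t * exp (r - t)"
    using exp_ge_add_one_self[of "r - t"] by (intro mult_left_mono) auto
  also have "\<dots> = exp r" by (simp flip: exp_add)
  finally have "exp t * (1 + (r - t)) \<le> exp r" .
  moreover have "1 * (r - t) \<le> exp t * (r - t)"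
    using assms by (intro mult_right_mono) auto
  ultimately have 1: "r - t \<le> exp r - exp t" by (simp add: algebra_simps)
  have "r * (r + t) \<le> r * (r + r)" using assms by (intro mult_left_mono) auto
  also have "\<dots> \<le> 1 - r\<^sup>2" using r2 by (simp add: power2_eq_square)
  finally have "(r - t) * (r * (r + t)) \<le> (r - t) * (1 - r\<^sup>2)"
    using assms by (intro mult_left_mono) auto
  hence "(r - t) * (r * (r + t)) / (1 - r\<^sup>2) \<le> r - t"
    using r2 by (simp add: divide_le_eq)
  moreover have "r * ((1 - t\<^sup>2) / (1 - r\<^sup>2)) - r = (r - t) * (r * (r + t)) / (1 - r\<^sup>2)"
    using r2 by (simp add: divide_simps) (simp add: power2_eq_square algebra_simps)
  ultimately show ?thesis using 1 by linarith
qed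

lemma schwarz_function_Re_bound:
  assumes "schwarz_function \<omega>" "norm z \<le> 1 / 2"
  shows "Re (exp (\<omega> z) + z * deriv \<omega> z) \<le> exp (norm z) + norm z"
proof -
  have \<omega>: "\<omega> holomorphic_on \<D>" "\<omega> 0 = 0" "\<And>z. norm z < 1 \<Longrightarrow> norm (\<omega> z) < 1"
    using assms by (auto simp: schwarz_function_def)
  have z: "norm z < 1" using assms by simp
  have "norm (deriv \<omega> z) \<le> (1 - (norm (\<omega> z))\<^sup>2) / (1 - (norm z)\<^sup>2)"
    using Schwarz_Pick_deriv[OF \<omega>(1,3) z] z by (simp add: pos_le_divide_eq power_less_one_iff)
  hence "norm (z * deriv \<omega> z) \<le> norm z * ((1 - (norm (\<omega> z))\<^sup>2) / (1 - (norm z)\<^sup>2))"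
    unfolding norm_mult by (rule mult_left_mono) simp
  moreover have "Re (exp (\<omega> z) + z * deriv \<omega> z) \<le> norm (exp (\<omega> z)) + norm (z * deriv \<omega> z)"
    by (rule order_trans[OF complex_Re_le_cmod norm_triangle_ineq])
  moreover have "norm (exp (\<omega> z)) \<le> exp (norm (\<omega> z))" by (rule norm_exp)
  moreover have "exp (norm (\<omega> z)) + norm z * ((1 - (norm (\<omega> z))\<^sup>2) / (1 - (norm z)\<^sup>2))
      \<le> exp (norm z) + norm z"
    by (rule exp_add_Schwarz_Pick_bound_le) (use Schwarz_Lemma(1)[OF \<omega> z] assms in auto)
  ultimately show ?thesis by linarith
qed

lemma Re_T_op_ge_Phi1:
  assumes A: "1 < A" and f: "f \<in> class_S_e" and z: "norm z \<le> 1 / 2"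
  shows "2 / (A - 1) * Phi1 A (norm z) \<le> Re (T_op A f z)"
proof -
  have z': "z \<in> \<D>" using z by simp
  obtain \<omega> where \<omega>: "schwarz_function \<omega>" "\<And>z. z \<in> \<D> \<Longrightarrow> z * deriv f z = f z * exp (\<omega> z)"
    "\<And>z. z \<in> \<D> \<Longrightarrow> deriv f z \<noteq> 0"
    using class_S_e_schwarzE[OF f] by blast
  have T: "Re (T_op A f z) =
      2 / (A - 1) * ((A + 1) / 2 * Re ((1 + z) / (1 - z)) - Re (exp (\<omega> z) + z * deriv \<omega> z))"
    by (rule Re_T_op_schwarz[OF f \<omega>(1) _ z']) (use \<omega>(2,3) z' in auto)
  have "(A + 1) / 2 * ((1 - norm z) / (1 + norm z)) \<le> (A + 1) / 2 * Re ((1 + z) / (1 - z))"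
    using A z by (intro mult_left_mono Re_Cayley_ge) auto
  with schwarz_function_Re_bound[OF \<omega>(1) z]
  have "Phi1 A (norm z) \<le> (A + 1) / 2 * Re ((1 + z) / (1 - z)) - Re (exp (\<omega> z) + z * deriv \<omega> z)"
    unfolding Phi1_def by linarith
  thus ?thesis
    unfolding T using A by (intro mult_left_mono) auto
qed

section \<open>The root of the radius equation\<close>

lemma Phi1_strict_antimono:
  assumes "1 < A" "0 \<le> r" "r < s"
  shows "Phi1 A s < Phi1 A r"
proof -
  have "(1 - s) / (1 + s) \<le> (1 - r) / (1 + r)"
    using assms by (simp add: divide_simps) (simp add: algebra_simps)
  hence "(A + 1) / 2 * ((1 - s) / (1 + s)) \<le> (A + 1) / 2 * ((1 - r) / (1 + r))"
    using assms by (intro mult_left_mono) auto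
  moreover have "exp r < exp s" using assms by simp
  ultimately show ?thesis using assms unfolding Phi1_def by linarith
qed

lemma Phi1_half_neg:
  assumes "A \<le> 2"
  shows "Phi1 A (1 / 2) < 0"
proof -
  have "1 < exp (1 / 2 :: real)" by simp
  moreover have "(A + 1) / 2 * ((1 - 1 / 2) / (1 + 1 / 2)) \<le> 1 / 2"
    using assms by simp
  ultimately show ?thesis unfolding Phi1_def by linarith
qed

lemma Phi1_root_exists:
  assumes A: "1 < A" "A \<le> 2"
  obtains R where "R \<in> {0<..<1}" "Phi1 A R = 0"
proof -
  have "continuous_on {0..1/2} (Phi1 A)"
    unfolding Phi1_def by (intro continuous_intros) auto
  moreover have p0: "0 < Phi1 A 0" using A by (simp add: Phi1_def)
  ultimately obtain R where "0 \<le> R" "R \<le> 1 / 2" "Phi1 A R = 0"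
    using IVT2'[of "Phi1 A" "1/2" 0 0] Phi1_half_neg[OF A(2)] by auto
  moreover from this p0 have "R \<noteq> 0" by auto
  ultimately show ?thesis by (intro that[of R]) auto
qed

section \<open>Starlike functions are univalent\<close>

text \<open>The Noshiro--Warschawski theorem: by the mean value theorem on the segment from \<open>a\<close> to \<open>b\<close>,
  the real part of the difference quotient of \<open>f\<close> is a value of \<open>Re f'\<close>.\<close>

lemma inj_on_convex_if_Re_deriv_pos:
  fixes f :: "complex \<Rightarrow> complex"
  assumes "convex S" and d: "\<And>z. z \<in> S \<Longrightarrow> (f has_field_derivative f' z) (at z)"
    and pos: "\<And>z. z \<in> S \<Longrightarrow> 0 < Re (f' z)"
  shows "inj_on f S"
proof (rule inj_onI, rule ccontr)
  fix a b assume ab: "a \<in> S" "b \<in> S" "f a = f b" "a \<noteq> b"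
  have sub: "closed_segment a b \<subseteq> S" using ab assms(1) by (simp add: closed_segment_subset)
  have "((\<lambda>z. f z / (b - a)) has_field_derivative f' u / (b - a)) (at u)"
    if "u \<in> closed_segment a b" for u
    using d that sub by (intro DERIV_cdivide) auto
  from complex_mvt_line[of a b, OF this] obtain u where
    u: "u \<in> closed_segment a b" "Re (f b / (b - a)) - Re (f a / (b - a)) = Re (f' u / (b - a) * (b - a))"
    by blast
  thus False using ab pos[of u] sub by auto
qed

text \<open>In the coordinate \<open>s = log z\<close>, which maps the punctured disc to the left half-plane modulo
  \<open>2\<pi>i\<close>, a logarithm of \<open>z e\<^bsup>h(z)\<^esup>\<close> is \<open>s + h(e\<^bsup>s\<^esup>)\<close>. The hypothesis says that its derivative has
  positive real part, so it is injective; and it commutes with the translation by \<open>2\<pi>i\<close>, so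
  injectivity descends to the quotient. The hypothesis is starlikeness, since
  \<open>1 + z h'(z)\<close> is \<open>z f'(z) / f(z)\<close> for \<open>f(z) = z e\<^bsup>h(z)\<^esup>\<close>.\<close>

lemma starlike_imp_inj_on:
  assumes h: "h holomorphic_on \<D>" and pos: "\<And>z. z \<in> \<D> \<Longrightarrow> 0 < Re (1 + z * deriv h z)"
  shows "inj_on (\<lambda>z. z * exp (h z)) \<D>"
proof (rule inj_onI)
  fix a b assume a: "a \<in> \<D>" and b: "b \<in> \<D>" and eq: "a * exp (h a) = b * exp (h b)"
  define H where "H = {s. Re s < 0}"
  define F where "F = (\<lambda>s. s + h (exp s))"
  have exp_in: "exp s \<in> \<D>" if "s \<in> H" for s using that by (simp add: H_def)
  have inj: "inj_on F H"
  proof (rule inj_on_convex_if_Re_deriv_pos)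
    show "convex H" unfolding H_def by (rule convex_halfspace_Re_lt)
    fix s assume s: "s \<in> H"
    have "(h has_field_derivative deriv h (exp s)) (at (exp s))"
      by (rule holomorphic_derivI[OF h _ exp_in[OF s]]) simp
    thus "(F has_field_derivative 1 + exp s * deriv h (exp s)) (at s)"
      unfolding F_def by (auto intro!: derivative_eq_intros DERIV_chain2[of h])
    show "0 < Re (1 + exp s * deriv h (exp s))" by (rule pos[OF exp_in[OF s]])
  qed
  show "a = b"
  proof (cases "a = 0 \<or> b = 0")
    case True thus ?thesis using eq by auto
  next
    case False
    hence e: "exp (Ln a) = a" "exp (Ln b) = b" by auto
    have "exp (F (Ln a)) = exp (F (Ln b))" using eq e by (simp add: F_def exp_add)
    then obtain n :: int where n: "F (Ln a) = F (Ln b) + of_int (2 * n) * of_real pi * \<i>"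
      unfolding exp_eq by auto
    define s where "s = Ln b + of_int (2 * n) * of_real pi * \<i>"
    have es: "exp s = b" using e(2) exp_eq[of s "Ln b"] by (auto simp: s_def)
    have "F s = F (Ln a)" using n es e(2) by (simp add: F_def s_def)
    moreover have "s \<in> H" "Ln a \<in> H"
      using a b False by (auto simp: H_def s_def)
    ultimately have "s = Ln a" using inj by (auto dest: inj_onD)
    thus ?thesis using es e(1) by simp
  qed
qed

section \<open>The extremal function\<close>

lemma extremal_function_exists:
  obtains f where "f \<in> class_S_e" "\<And>z. z \<in> \<D> \<Longrightarrow> z * deriv f z = f z * exp (- z)"
    "\<And>z. z \<in> \<D> \<Longrightarrow> deriv f z \<noteq> 0"
proof -
  \<comment> \<open>The value \<open>-1\<close> at the origin removes the singularity.\<close>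
  define q where "q = (\<lambda>z::complex. if z = 0 then - 1 else (exp (- z) - 1) / z)"
  have zq: "z * q z = exp (- z) - 1" for z by (simp add: q_def)
  have "deriv (\<lambda>z::complex. exp (- z) - 1) 0 = - 1"
    by (rule DERIV_imp_deriv) (auto intro!: derivative_eq_intros)
  hence "q holomorphic_on \<D>"
    by (intro pole_theorem_open_0[of "\<lambda>z. exp (- z) - 1" \<D> 0 q] holomorphic_intros)
       (auto simp: zq q_def)
  then obtain h0 where h0: "\<And>z. z \<in> \<D> \<Longrightarrow> (h0 has_field_derivative q z) (at z within \<D>)"
    using holomorphic_convex_primitive'[OF convex_ball open_ball, of q 0 1] by blast
  \<comment> \<open>The primitive must vanish at the origin for \<open>f'(0) = e\<^bsup>h(0)\<^esup>\<close> to be \<open>1\<close>.\<close>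
  define h where "h = (\<lambda>z. h0 z - h0 0)"
  have dh: "(h has_field_derivative q z) (at z)" if "z \<in> \<D>" for z
    using h0[OF that] at_within_open[OF that open_ball] unfolding h_def
    by (auto intro!: derivative_eq_intros)
  have holh: "h holomorphic_on \<D>"
    unfolding holomorphic_on_open[OF open_ball] using dh by blast
  define f where "f = (\<lambda>z. z * exp (h z))"
  have df: "deriv f z = exp (h z) * exp (- z)" if "z \<in> \<D>" for z
  proof (rule DERIV_imp_deriv)
    have "(f has_field_derivative exp (h z) + z * (exp (h z) * q z)) (at z)"
      unfolding f_def using dh[OF that] by (auto intro!: derivative_eq_intros)
    also have "exp (h z) + z * (exp (h z) * q z) = exp (h z) * (1 + z * q z)"
      by (simp add: algebra_simps)
    finally show "(f has_field_derivative exp (h z) * exp (- z)) (at z)" by (simp add: zq)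
  qed
  have inj: "inj_on f \<D>"
    unfolding f_def
  proof (rule starlike_imp_inj_on[OF holh])
    fix z :: complex assume z: "z \<in> \<D>"
    \<comment> \<open>The values of \<open>e\<^bsup>-z\<^esup>\<close> have argument \<open>- Im z\<close>, and \<open>1 < \<pi>/2\<close>.\<close>
    have "\<bar>Im z\<bar> < pi / 2" using z abs_Im_le_cmod[of z] pi_gt3 by auto
    hence "0 < cos (Im z)" by (intro cos_gt_zero_pi) auto
    thus "0 < Re (1 + z * deriv h z)"
      using DERIV_imp_deriv[OF dh[OF z]] by (simp add: zq Re_exp)
  qed
  have "f holomorphic_on \<D>" unfolding f_def by (intro holomorphic_intros holh)
  moreover have "f 0 = 0" "deriv f 0 = 1" using df[of 0] by (auto simp: f_def h_def)
  moreover have "starlike_quotient f z = exp (- z)" if "z \<in> \<D>" for z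
    using df[OF that] by (simp add: starlike_quotient_def f_def)
  hence "starlike_quotient f \<prec>\<^sub>s exp"
    unfolding subordinate_def schwarz_function_def
    by (intro exI[of _ uminus]) (auto intro!: holomorphic_intros)
  ultimately have "f \<in> class_S_e"
    using inj by (simp add: class_S_e_def class_S_def class_A_def)
  thus ?thesis by (rule that) (use df in \<open>auto simp: f_def\<close>)
qed

text \<open>At \<open>z = -r\<close> both competing terms are extreme: \<open>(1 + z) / (1 - z)\<close> is the least possible value
  \<open>(1 - r) / (1 + r)\<close>, and \<open>e\<^bsup>-z\<^esup> - z\<close> is \<open>e\<^bsup>r\<^esup> + r\<close>. This is why the Schwarz function is \<open>-z\<close> and not
  \<open>z\<close>: the latter is extreme at \<open>z = r\<close>, where the first term is at its greatest.\<close>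

lemma extremal_T_op_eq_Phi1:
  obtains f where "f \<in> class_S_e"
    "\<And>A r. 0 \<le> r \<Longrightarrow> r < 1 \<Longrightarrow> Re (T_op A f (- of_real r)) = 2 / (A - 1) * Phi1 A r"
proof -
  obtain f where f: "f \<in> class_S_e" "\<And>z. z \<in> \<D> \<Longrightarrow> z * deriv f z = f z * exp (- z)"
    "\<And>z. z \<in> \<D> \<Longrightarrow> deriv f z \<noteq> 0"
    using extremal_function_exists by blast
  have sw: "schwarz_function uminus"
    by (auto simp: schwarz_function_def intro!: holomorphic_intros)
  have "Re (T_op A f (- of_real r)) = 2 / (A - 1) * Phi1 A r" if r: "0 \<le> r" "r < 1" for A r
  proof -
    have z: "- complex_of_real r \<in> \<D>" using r by simp
    have T: "Re (T_op A f (- of_real r)) = 2 / (A - 1) *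
        ((A + 1) / 2 * Re ((1 + - complex_of_real r) / (1 - - complex_of_real r))
          - Re (exp (- (- complex_of_real r)) + - complex_of_real r * deriv uminus (- of_real r)))"
      by (rule Re_T_op_schwarz[OF f(1) sw _ z]) (use f(2,3) z in auto)
    have d: "deriv uminus (- complex_of_real r) = - 1"
      by (rule DERIV_imp_deriv) (auto intro!: derivative_eq_intros)
    have "(1 + - complex_of_real r) / (1 - - complex_of_real r) = of_real ((1 - r) / (1 + r))"
      by simp
    hence "Re ((1 + - complex_of_real r) / (1 - - complex_of_real r)) = (1 - r) / (1 + r)"
      by (simp only: Re_complex_of_real)
    moreover have "Re (exp (- (- complex_of_real r)) + - complex_of_real r * - 1) = exp r + r"
      by (simp add: Re_exp)
    ultimately show ?thesis
      unfolding T d Phi1_def by (simp add: algebra_simps)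
  qed
  with f(1) show ?thesis by (rule that)
qed

section \<open>The radius of concavity\<close>

theorem theorem3p1:
  fixes A :: real
  assumes "1 < A" and "A \<le> 2"
  shows "(\<exists>!R. R \<in> {0<..<1} \<and> Phi1 A R = 0) \<and>
    (\<forall>R. R \<in> {0<..<1} \<and> Phi1 A R = 0 \<longrightarrow>
      (\<forall>f\<in>class_S_e. \<forall>z. norm z < R \<longrightarrow> Re (T_op A f z) > 0) \<and>
      is_radius_of_concavity A class_S_e R)"
proof (intro conjI allI impI)
  have uniq: "R = S" if "R \<in> {0<..<1}" "Phi1 A R = 0" "S \<in> {0<..<1}" "Phi1 A S = 0" for R S
    using Phi1_strict_antimono[OF assms(1), of R S] Phi1_strict_antimono[OF assms(1), of S R] that
    by (cases R S rule: linorder_cases) auto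
  show "\<exists>!R. R \<in> {0<..<1} \<and> Phi1 A R = 0"
    using Phi1_root_exists[OF assms] uniq by metis
next
  fix R assume "R \<in> {0<..<1} \<and> Phi1 A R = 0"
  hence R: "0 < R" "R < 1" "Phi1 A R = 0" by auto
  have half: "R < 1 / 2"
  proof (cases R "1 / 2 :: real" rule: linorder_cases)
    case equal
    thus ?thesis using R(3) Phi1_half_neg[OF assms(2)] by (metis less_irrefl)
  next
    case greater
    hence "Phi1 A R < Phi1 A (1 / 2)" by (intro Phi1_strict_antimono assms) simp_all
    thus ?thesis using R(3) Phi1_half_neg[OF assms(2)] by linarith
  qed
  show pos: "\<forall>f\<in>class_S_e. \<forall>z. norm z < R \<longrightarrow> Re (T_op A f z) > 0"
  proof (intro ballI allI impI)
    fix f and z :: complex assume f: "f \<in> class_S_e" and z: "norm z < R"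
    have "0 < Phi1 A (norm z)"
      using Phi1_strict_antimono[OF assms(1) norm_ge_zero z] R(3) by simp
    hence "0 < 2 / (A - 1) * Phi1 A (norm z)" using assms by simp
    also have "\<dots> \<le> Re (T_op A f z)"
      by (rule Re_T_op_ge_Phi1[OF assms(1) f]) (use z half in simp)
    finally show "Re (T_op A f z) > 0" .
  qed
  have "\<rho> \<le> R" if \<rho>: "concave_up_to A class_S_e \<rho>" for \<rho>
  proof (rule ccontr)
    assume "\<not> \<rho> \<le> R"
    obtain f where f: "f \<in> class_S_e" "Re (T_op A f (- of_real R)) = 2 / (A - 1) * Phi1 A R"
      using extremal_T_op_eq_Phi1 R by (metis less_imp_le)
    have "norm (- complex_of_real R) < \<rho>" using R \<open>\<not> \<rho> \<le> R\<close> by simp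
    hence "0 < Re (T_op A f (- of_real R))" using \<rho> f(1) unfolding concave_up_to_def by blast
    thus False using f(2) R(3) by simp
  qed
  thus "is_radius_of_concavity A class_S_e R"
    using pos R by (auto simp: is_radius_of_concavity_def concave_up_to_def)
qed

end
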